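(* Let $n=6$ and consider the square board of $(n+1)\times(n+1)=7\times 7$ cells. The number of equivalence classes of closed knight paths of length $6$ on this board is exactly $25$.
   Context: Cells of an $m\times m$ board are identified with pairs $(i,j)\in\{1,\dots,m\}^2$. Two cells $(i,j),(i',j')$ are a knight's move apart if $\{|i-i'|,|j-j'|\}=\{1,2\}$. A closed knight path of length $n$ on the board is a set of $n$ distinct cells that can be listed as $c_1,\dots,c_n$ so that $c_k$ and $c_{k+1}$ are a knight's move apart for $k=1,\dots,n-1$, and $c_n$ and $c_1$ are a knight's move apart (i.e. the set can be traversed by a closed knight path visiting each of its cells exactly once). Two such sets are equivalent if one can be obtained from the other by a finite sequence of the following transformations, each keeping all cells on the board: translation (shifting every cell by one step up, down, left or right), rotation of the board by $90^\circ$, and reflection of the board (these rotations and reflections generate the dihedral group of order 8 of symmetries of the square board). *)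

theory Defs
  imports Main
begin

type_synonym cell = "int \<times> int"

definition board :: "nat \<Rightarrow> cell set" where
  "board m = {1..int m} \<times> {1..int m}"

fun knight_move :: "cell \<Rightarrow> cell \<Rightarrow> bool" where
  "knight_move (i, j) (i', j') \<longleftrightarrow> {\<bar>i - i'\<bar>, \<bar>j - j'\<bar>} = {1, 2}"

text \<open>A closed knight path is a set of cells; the list is only a witness of a closed traversal.
  Indices are 0-based. The definition is meant for \<open>n > 0\<close>.\<close>

definition closed_knight_paths :: "nat \<Rightarrow> nat \<Rightarrow> cell set set" where
  "closed_knight_paths m n =
    {A. A \<subseteq> board m \<and>
      (\<exists>c :: cell list. length c = n \<and> distinct c \<and> set c = A \<and>
        (\<forall>k. k + 1 < n \<longrightarrow> knight_move (c ! k) (c ! (k + 1))) \<and>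
        knight_move (c ! (n - 1)) (c ! 0))}"

definition unit_translations :: "(cell \<Rightarrow> cell) set" where
  "unit_translations =
    {\<lambda>(i, j). (i + 1, j), \<lambda>(i, j). (i - 1, j), \<lambda>(i, j). (i, j + 1), \<lambda>(i, j). (i, j - 1)}"

definition quarter_turns :: "nat \<Rightarrow> (cell \<Rightarrow> cell) set" where
  "quarter_turns m = {\<lambda>(i, j). (j, int m + 1 - i), \<lambda>(i, j). (int m + 1 - j, i)}"

text \<open>The reflections in the two axes parallel to the sides and in the two diagonals.\<close>

definition reflections :: "nat \<Rightarrow> (cell \<Rightarrow> cell) set" where
  "reflections m =
    {\<lambda>(i, j). (int m + 1 - i, j), \<lambda>(i, j). (i, int m + 1 - j),
     \<lambda>(i, j). (j, i), \<lambda>(i, j). (int m + 1 - j, int m + 1 - i)}"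

definition elementary_step :: "nat \<Rightarrow> (cell set \<times> cell set) set" where
  "elementary_step m =
    {(A, B). A \<subseteq> board m \<and> B \<subseteq> board m \<and>
      (\<exists>f \<in> unit_translations \<union> quarter_turns m \<union> reflections m. B = f ` A)}"

definition path_equiv :: "nat \<Rightarrow> nat \<Rightarrow> (cell set \<times> cell set) set" where
  "path_equiv m n =
    (elementary_step m)\<^sup>* \<inter> (closed_knight_paths m n \<times> closed_knight_paths m n)"

lemma sym_elementary_step: "sym (elementary_step m)"
proof (rule symI)
  fix A B assume "(A, B) \<in> elementary_step m"
  then obtain f where AB: "A \<subseteq> board m" "B \<subseteq> board m" "B = f ` A"
    and f: "f \<in> unit_translations \<union> quarter_turns m \<union> reflections m"
    by (auto simp: elementary_step_def)
  have "\<exists>g \<in> unit_translations \<union> quarter_turns m \<union> reflections m. \<forall>x. g (f x) = x"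
    using f unfolding unit_translations_def quarter_turns_def reflections_def Un_iff insert_iff empty_iff
    by (elim disjE; simp)
  then obtain g where g: "g \<in> unit_translations \<union> quarter_turns m \<union> reflections m"
    and gf: "\<And>x. g (f x) = x" by blast
  have "A = g ` B" using AB(3) gf by (simp add: image_image)
  then show "(B, A) \<in> elementary_step m"
    using AB(1,2) g unfolding elementary_step_def by blast
qed

lemma equiv_path_equiv: "equiv (closed_knight_paths m n) (path_equiv m n)"
proof (rule equivI)
  show "path_equiv m n \<subseteq> closed_knight_paths m n \<times> closed_knight_paths m n"
    by (auto simp: path_equiv_def)
  show "refl_on (closed_knight_paths m n) (path_equiv m n)"
    by (auto simp: path_equiv_def refl_on_def)
  show "sym (path_equiv m n)"
    using sym_rtrancl[OF sym_elementary_step[of m]]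
    by (auto simp: path_equiv_def sym_def)
  show "trans (path_equiv m n)"
    by (auto simp: path_equiv_def intro!: transI)
qed

end

theory Submission
  imports Defs
begin

text \<open>On the board, equivalence is congruence: a congruence of the lattice is a board symmetry
  followed by a translation, and a translation between two sets on the board can be done in unit
  steps along the axes without leaving the board. A closed path of six cells is congruent to one
  that starts at the origin with the move \<open>(1, 2)\<close>, and a finite search shows that each of
  these is congruent to one of 25 representatives. The representatives are pairwise incongruent
  because a congruence between sets with the same coordinate minima is one of eight maps.\<close>

section \<open>Congruence of sets of cells\<close>

fun signed_perm :: "bool \<times> int \<times> int \<Rightarrow> cell \<Rightarrow> cell" where
  "signed_perm (s, a, b) (i, j) = (if s then (a * j, b * i) else (a * i, b * j))"

fun shift :: "cell \<Rightarrow> cell \<Rightarrow> cell" where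
  "shift (p, q) (i, j) = (i + p, j + q)"

text \<open>These are the eight symmetries of the square lattice that fix the origin, kept as a list
  of data so that the search can run over them.\<close>

definition signed_perms :: "(bool \<times> int \<times> int) list" where
  "signed_perms = List.product [False, True] (List.product [1, -1] [1, -1])"

text \<open>The linear part acts first, so composing two congruences only requires the inner
  translation to be moved outwards by \<open>signed_perm_shift\<close>.\<close>

definition congruent_sets :: "cell set \<Rightarrow> cell set \<Rightarrow> bool" where
  "congruent_sets A B \<longleftrightarrow> (\<exists>g \<in> set signed_perms. \<exists>t. B = shift t ` signed_perm g ` A)"

lemma set_signed_perms: "set signed_perms = UNIV \<times> {1, -1} \<times> {1, -1}"
  by (auto simp: signed_perms_def)

lemma signed_perm_comp:
  assumes "g \<in> set signed_perms" "h \<in> set signed_perms"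
  obtains k where "k \<in> set signed_perms" "\<And>x. signed_perm h (signed_perm g x) = signed_perm k x"
proof -
  obtain s a b s' a' b' where gh: "g = (s, a, b)" "h = (s', a', b')"
    by (metis prod.exhaust)
  \<comment> \<open>Two swaps cancel, and an outer swap exchanges the inner signs before the outer
    signs multiply them.\<close>
  let ?k = "(s \<noteq> s', a' * (if s' then b else a), b' * (if s' then a else b))"
  have "?k \<in> set signed_perms"
    using assms by (auto simp: gh set_signed_perms)
  moreover have "signed_perm h (signed_perm g x) = signed_perm ?k x" for x
    by (cases x) (simp add: gh)
  ultimately show thesis by (rule that)
qed

lemma signed_perm_shift:
  "signed_perm g (shift t x) = shift (signed_perm g t) (signed_perm g x)"
  by (cases g; cases t; cases x) (simp add: distrib_left)

lemma shift_shift: "shift t (shift u x) = shift (shift t u) x"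
  by (cases t; cases u; cases x) simp

lemma congruent_sets_trans:
  assumes "congruent_sets A B" "congruent_sets B C"
  shows "congruent_sets A C"
proof -
  obtain g t h u where gh: "g \<in> set signed_perms" "h \<in> set signed_perms"
    and BC: "B = shift t ` signed_perm g ` A" "C = shift u ` signed_perm h ` B"
    using assms by (auto simp: congruent_sets_def)
  obtain k where k: "k \<in> set signed_perms" "\<And>x. signed_perm h (signed_perm g x) = signed_perm k x"
    using signed_perm_comp gh by blast
  have "C = shift (shift u (signed_perm h t)) ` signed_perm k ` A"
    by (simp add: BC image_image signed_perm_shift shift_shift k)
  with k(1) show ?thesis unfolding congruent_sets_def by blast
qed

lemma congruent_sets_image:
  assumes "g \<in> set signed_perms" "\<And>x. f x = shift t (signed_perm g x)"
  shows "congruent_sets A (f ` A)"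
proof -
  have "f ` A = shift t ` signed_perm g ` A"
    by (simp add: assms(2) image_image)
  with assms(1) show ?thesis unfolding congruent_sets_def by blast
qed

lemma congruent_sets_refl: "congruent_sets A A"
  using congruent_sets_image[of "(False, 1, 1)" id "(0, 0)" A]
  by (force simp: set_signed_perms)

text \<open>Each generator is affine with a signed permutation as its linear part; a board symmetry
  adds the constant \<open>int m + 1\<close> to each negated coordinate.\<close>

lemma elementary_step_imp_congruent:
  assumes "(A, B) \<in> elementary_step m"
  shows "congruent_sets A B"
proof -
  obtain f where f: "f \<in> unit_translations \<union> quarter_turns m \<union> reflections m" and B: "B = f ` A"
    using assms by (auto simp: elementary_step_def)
  have image: "congruent_sets A B"
    if "g \<in> set signed_perms" "\<And>i j. f (i, j) = shift t (signed_perm g (i, j))" for g t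
    unfolding B using that by (intro congruent_sets_image[of g]) auto
  show ?thesis
    using f unfolding unit_translations_def quarter_turns_def reflections_def Un_iff insert_iff empty_iff
    apply (elim disjE FalseE)
    subgoal by (rule image[of "(False, 1, 1)" "(1, 0)"]) (simp_all add: set_signed_perms)
    subgoal by (rule image[of "(False, 1, 1)" "(-1, 0)"]) (simp_all add: set_signed_perms)
    subgoal by (rule image[of "(False, 1, 1)" "(0, 1)"]) (simp_all add: set_signed_perms)
    subgoal by (rule image[of "(False, 1, 1)" "(0, -1)"]) (simp_all add: set_signed_perms)
    subgoal by (rule image[of "(True, 1, -1)" "(0, int m + 1)"]) (simp_all add: set_signed_perms)
    subgoal by (rule image[of "(True, -1, 1)" "(int m + 1, 0)"]) (simp_all add: set_signed_perms)
    subgoal by (rule image[of "(False, -1, 1)" "(int m + 1, 0)"]) (simp_all add: set_signed_perms)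
    subgoal by (rule image[of "(False, 1, -1)" "(0, int m + 1)"]) (simp_all add: set_signed_perms)
    subgoal by (rule image[of "(True, 1, 1)" "(0, 0)"]) (simp_all add: set_signed_perms)
    subgoal by (rule image[of "(True, -1, -1)" "(int m + 1, int m + 1)"]) (simp_all add: set_signed_perms)
    done
qed

lemma rtrancl_elementary_step_imp_congruent:
  "(A, B) \<in> (elementary_step m)\<^sup>* \<Longrightarrow> congruent_sets A B"
  by (induction rule: rtrancl_induct)
    (auto intro: congruent_sets_refl congruent_sets_trans elementary_step_imp_congruent)

section \<open>Realising congruences by steps on the board\<close>

text \<open>Rows and columns of the board are intervals: on the way each cell lies between its first
  and last position, so no intermediate set leaves the board.\<close>

lemma unit_shifts_reachable:
  fixes k :: nat
  assumes d: "d = (1, 0) \<or> d = (0, 1)"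
    and "A \<subseteq> board m" "(\<lambda>(i, j). (i + int k * fst d, j + int k * snd d)) ` A \<subseteq> board m"
  shows "(A, (\<lambda>(i, j). (i + int k * fst d, j + int k * snd d)) ` A) \<in> (elementary_step m)\<^sup>*"
  using assms(2,3)
proof (induction k)
  case 0
  then show ?case by (simp add: case_prod_unfold)
next
  case (Suc k)
  let ?f = "\<lambda>k. \<lambda>(i, j). (i + int k * fst d, j + int k * snd d)"
  have mid: "?f k ` A \<subseteq> board m"
  proof
    fix y assume "y \<in> ?f k ` A"
    then obtain i j where ij: "(i, j) \<in> A" "y = ?f k (i, j)" by auto
    have "(i, j) \<in> board m" "?f (Suc k) (i, j) \<in> board m"
      using ij(1) Suc.prems by blast+
    then show "y \<in> board m"
      using d by (auto simp: ij(2) board_def)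
  qed
  have "?f (Suc k) ` A = (\<lambda>(i, j). (i + fst d, j + snd d)) ` ?f k ` A"
    by (simp add: image_image case_prod_unfold algebra_simps)
  moreover have "(\<lambda>(i, j). (i + fst d, j + snd d)) \<in> unit_translations"
    using d by (auto simp: unit_translations_def)
  ultimately have "(?f k ` A, ?f (Suc k) ` A) \<in> elementary_step m"
    using mid Suc.prems(2) unfolding elementary_step_def by blast
  with Suc.IH[OF Suc.prems(1) mid] show ?case by (rule rtrancl_into_rtrancl)
qed

lemma axis_shift_reachable:
  assumes d: "d = (1, 0) \<or> d = (0, 1)"
    and A: "A \<subseteq> board m" and B: "shift (k * fst d, k * snd d) ` A \<subseteq> board m"
  shows "(A, shift (k * fst d, k * snd d) ` A) \<in> (elementary_step m)\<^sup>*"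
proof (cases "k \<ge> 0")
  case True
  then have "shift (k * fst d, k * snd d)
      = (\<lambda>(i, j). (i + int (nat k) * fst d, j + int (nat k) * snd d))"
    by auto
  with unit_shifts_reachable[OF d A, of "nat k"] B show ?thesis by simp
next
  case False
  let ?B = "shift (k * fst d, k * snd d) ` A"
  \<comment> \<open>A negative shift is the inverse of a positive one, and elementary steps are
    reversible.\<close>
  have "A = (\<lambda>(i, j). (i + int (nat (-k)) * fst d, j + int (nat (-k)) * snd d)) ` ?B"
    using False by (simp add: image_image case_prod_unfold split: prod.split) (force simp: image_iff)
  with unit_shifts_reachable[OF d B, of "nat (-k)"] A have "(?B, A) \<in> (elementary_step m)\<^sup>*"
    by simp
  then show ?thesis
    using sym_rtrancl[OF sym_elementary_step] by (meson symD)
qed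

lemma shift_reachable:
  assumes A: "A \<subseteq> board m" and B: "shift t ` A \<subseteq> board m"
  shows "(A, shift t ` A) \<in> (elementary_step m)\<^sup>*"
proof -
  obtain p q where t: "t = (p, q)" by (cases t)
  let ?C = "shift (p, 0) ` A"
  \<comment> \<open>First coordinates in \<open>?C\<close> are those of the final set, second
    coordinates those of \<open>A\<close>, and the board is a product of intervals.\<close>
  have C: "?C \<subseteq> board m"
  proof
    fix y assume "y \<in> ?C"
    then obtain i j where ij: "(i, j) \<in> A" "y = (i + p, j)" by auto
    have "(i, j) \<in> board m" using ij A by blast
    moreover have "shift t (i, j) \<in> board m" using ij B by blast
    ultimately show "y \<in> board m"
      by (auto simp: ij board_def t)
  qed
  have eq: "shift t ` A = shift (0, q) ` ?C"
    by (simp add: t image_image shift_shift)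
  have "(A, ?C) \<in> (elementary_step m)\<^sup>*"
    using axis_shift_reachable[of "(1, 0)" A m p] A C by simp
  also have "(?C, shift t ` A) \<in> (elementary_step m)\<^sup>*"
    using axis_shift_reachable[of "(0, 1)" ?C m q] B C by (simp add: eq)
  finally show ?thesis .
qed

text \<open>Six of the eight board symmetries are elementary quarter turns or reflections; the
  identity takes no step and the half turn is a product of two reflections.\<close>

lemma board_symmetry_reachable:
  assumes A: "A \<subseteq> board m" and g: "g \<in> set signed_perms"
  obtains t where "shift t ` signed_perm g ` A \<subseteq> board m"
    "(A, shift t ` signed_perm g ` A) \<in> (elementary_step m)\<^sup>*"
proof -
  let ?M = "int m + 1"
  obtain s a b where gs: "g = (s, a, b)" by (cases g)
  \<comment> \<open>A coordinate with sign -1 lands in \<open>{- int m..-1}\<close>; adding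
    \<open>?M\<close> brings it back onto the board.\<close>
  let ?t = "(if a = 1 then 0 else ?M, if b = 1 then 0 else ?M)"
  have ab: "a = 1 \<or> a = -1" "b = 1 \<or> b = -1"
    using g by (auto simp: gs set_signed_perms)
  let ?f = "\<lambda>x. shift ?t (signed_perm g x)"
  have board: "?f x \<in> board m" if "x \<in> board m" for x
    using that ab by (cases x) (auto simp: gs board_def)
  have sub: "?f ` A \<subseteq> board m"
    using A board by blast
  have step: "(C, f ` C) \<in> elementary_step m"
    if "f \<in> quarter_turns m \<union> reflections m" "C \<subseteq> board m" for f C
  proof -
    have "f ` C \<subseteq> board m"
      using that by (auto simp: quarter_turns_def reflections_def board_def)
    with that show ?thesis unfolding elementary_step_def by blast
  qed
  have "(A, ?f ` A) \<in> (elementary_step m)\<^sup>*"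
  proof (cases "s \<or> a \<noteq> b")
    case True
    then have "?f \<in> quarter_turns m \<union> reflections m"
      using ab unfolding quarter_turns_def reflections_def
      by (cases s) (elim disjE; simp add: gs fun_eq_iff)+
    then show ?thesis using step A by blast
  next
    case False
    show ?thesis
    proof (cases "a = 1")
      case True
      then have "?f ` A = A" using False by (force simp: gs image_iff)
      then show ?thesis by (simp only: rtrancl.rtrancl_refl)
    next
      case neg: False
      let ?h = "\<lambda>(i, j). (?M - i, j)" and ?v = "\<lambda>(i, j). (i, ?M - j)"
      have "(A, ?h ` A) \<in> elementary_step m"
        using A by (intro step) (auto simp: reflections_def)
      moreover have "?h ` A \<subseteq> board m"
        using calculation by (simp add: elementary_step_def)
      then have "(?h ` A, ?v ` ?h ` A) \<in> elementary_step m"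
        by (intro step) (auto simp: reflections_def)
      moreover have "?v ` ?h ` A = ?f ` A"
        using False neg ab by (auto simp: gs image_image intro!: image_cong)
      ultimately show ?thesis by (metis r_into_rtrancl rtrancl_trans)
    qed
  qed
  with sub show thesis by (intro that[of ?t]) (simp_all add: image_image)
qed

text \<open>The board symmetry with the same linear part leads to a set on the board that differs
  from \<open>B\<close> only by a translation.\<close>

lemma congruent_imp_reachable:
  assumes A: "A \<subseteq> board m" and B: "B \<subseteq> board m" and "congruent_sets A B"
  shows "(A, B) \<in> (elementary_step m)\<^sup>*"
proof -
  obtain g t where g: "g \<in> set signed_perms" and Bt: "B = shift t ` signed_perm g ` A"
    using assms(3) by (auto simp: congruent_sets_def)
  obtain u where C: "shift u ` signed_perm g ` A \<subseteq> board m"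
    and AC: "(A, shift u ` signed_perm g ` A) \<in> (elementary_step m)\<^sup>*"
    using board_symmetry_reachable A g by blast
  let ?C = "shift u ` signed_perm g ` A"
  have "B = shift (fst t - fst u, snd t - snd u) ` ?C"
    unfolding Bt image_image by (cases t; cases u) (simp add: shift_shift)
  then have "(?C, B) \<in> (elementary_step m)\<^sup>*"
    using shift_reachable[OF C] B by metis
  with AC show ?thesis by (rule rtrancl_trans)
qed

section \<open>The search\<close>

text \<open>Each representative is listed in the order of a closed traversal and placed so that both
  coordinate minima are 1.\<close>

definition representatives :: "cell list list" where
  "representatives = [
    [(1, 1), (2, 3), (3, 1), (1, 2), (2, 4), (3, 2)],
    [(1, 1), (2, 3), (1, 5), (3, 4), (1, 3), (3, 2)],
    [(1, 1), (2, 3), (4, 4), (2, 5), (1, 3), (3, 2)],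
    [(1, 1), (2, 3), (4, 2), (3, 4), (1, 3), (3, 2)],
    [(1, 1), (2, 3), (1, 5), (3, 6), (2, 4), (3, 2)],
    [(1, 1), (2, 3), (1, 5), (3, 4), (5, 3), (3, 2)],
    [(1, 1), (2, 3), (1, 5), (3, 6), (4, 4), (3, 2)],
    [(1, 1), (2, 3), (3, 5), (1, 6), (2, 4), (3, 2)],
    [(1, 1), (2, 3), (3, 5), (4, 3), (2, 4), (3, 2)],
    [(1, 1), (2, 3), (4, 4), (3, 6), (2, 4), (3, 2)],
    [(1, 1), (2, 3), (3, 5), (5, 6), (4, 4), (3, 2)],
    [(1, 2), (2, 4), (3, 2), (1, 3), (2, 1), (3, 3)],
    [(1, 2), (3, 1), (4, 3), (3, 5), (1, 4), (3, 3)],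
    [(1, 2), (2, 4), (4, 3), (3, 5), (2, 3), (3, 1)],
    [(1, 2), (2, 4), (3, 6), (4, 4), (2, 3), (3, 1)],
    [(1, 2), (3, 1), (2, 3), (4, 4), (2, 5), (3, 3)],
    [(1, 2), (3, 1), (2, 3), (3, 5), (5, 4), (3, 3)],
    [(1, 2), (2, 4), (4, 5), (3, 3), (5, 2), (3, 1)],
    [(1, 2), (2, 4), (3, 6), (5, 5), (4, 3), (3, 1)],
    [(1, 2), (2, 4), (3, 6), (4, 4), (5, 2), (3, 1)],
    [(1, 2), (2, 4), (4, 5), (6, 4), (4, 3), (3, 1)],
    [(1, 2), (2, 4), (4, 5), (6, 4), (5, 2), (3, 1)],
    [(1, 2), (3, 1), (4, 3), (6, 2), (4, 1), (3, 3)],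
    [(1, 2), (3, 1), (4, 3), (6, 4), (4, 5), (3, 3)],
    [(1, 2), (3, 1), (5, 2), (7, 3), (5, 4), (3, 3)]]"

text \<open>The default code equations use conjunction and disjunction, which the simplifier evaluates
  without short-circuiting; a conditional stops the search early.\<close>

lemma list_all_if [code]:
  "list_all P [] \<longleftrightarrow> True"
  "list_all P (x # xs) \<longleftrightarrow> (if P x then list_all P xs else False)"
  by simp_all

lemma list_ex_if [code]:
  "list_ex P [] \<longleftrightarrow> False"
  "list_ex P (x # xs) \<longleftrightarrow> (if P x then True else list_ex P xs)"
  by simp_all

text \<open>For a nonempty list this picks the translate placed like the representatives. The order
  of the cells is kept, so results have to be compared as sets.\<close>

definition normalize :: "cell list \<Rightarrow> cell list" where
  "normalize c = map (shift (1 - Min (fst ` set c), 1 - Min (snd ` set c))) c"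

definition same_cells :: "cell list \<Rightarrow> cell list \<Rightarrow> bool" where
  "same_cells c d \<longleftrightarrow>
    (if list_all (\<lambda>x. x \<in> set d) c then list_all (\<lambda>x. x \<in> set c) d else False)"

definition has_representative :: "cell list \<Rightarrow> bool" where
  "has_representative c \<longleftrightarrow>
    list_ex (\<lambda>g. list_ex (same_cells (normalize (map (signed_perm g) c))) representatives) signed_perms"

section \<open>Knight moves and lattice symmetries\<close>

text \<open>An arithmetic form for evaluation, where the definition compares two sets.\<close>

lemma knight_move_code [code]:
  "knight_move (i, j) (i', j') \<longleftrightarrow>
    (let a = \<bar>i - i'\<bar>; b = \<bar>j - j'\<bar> in a = 1 \<and> b = 2 \<or> a = 2 \<and> b = 1)"
  by (auto simp: Let_def doubleton_eq_iff)

definition knight_steps :: "cell list" where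
  "knight_steps = [(1, 2), (2, 1), (-1, 2), (-2, 1), (1, -2), (2, -1), (-1, -2), (-2, -1)]"

definition knight_nbrs :: "cell \<Rightarrow> cell list" where
  "knight_nbrs x = map (shift x) knight_steps"

lemma knight_move_nbrs: "knight_move x y \<Longrightarrow> y \<in> set (knight_nbrs x)"
  by (cases x; cases y)
    (auto simp: knight_nbrs_def knight_steps_def doubleton_eq_iff abs_if split: if_splits)

lemma knight_move_sym: "knight_move x y \<Longrightarrow> knight_move y x"
  by (cases x; cases y) (simp add: abs_minus_commute)

lemma knight_move_signed_perm:
  "g \<in> set signed_perms \<Longrightarrow> knight_move x y \<Longrightarrow> knight_move (signed_perm g x) (signed_perm g y)"
  by (cases x; cases y) (auto simp: set_signed_perms doubleton_eq_iff abs_if split: if_splits)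

lemma knight_move_shift: "knight_move x y \<Longrightarrow> knight_move (shift t x) (shift t y)"
  by (cases x; cases y; cases t) simp

lemma inj_signed_perm: "g \<in> set signed_perms \<Longrightarrow> inj (signed_perm g)"
  by (rule injI) (auto simp: set_signed_perms split: if_splits)

lemma inj_shift: "inj (shift t)"
  by (rule injI, cases t) auto

section \<open>Finite checks by evaluation\<close>

text \<open>Allows the first move of any path to be normalised to \<open>(1, 2)\<close>: the eight
  knight steps form a single orbit.\<close>

lemma knight_step_rotatable:
  "list_all (\<lambda>d. list_ex (\<lambda>g. signed_perm g d = (1, 2)) signed_perms) knight_steps"
  by code_simp

text \<open>The arms \<open>(0, 0), (1, 2), v2, v3\<close> and \<open>(0, 0), v5, v4\<close> of the path are grown separately,
  so that only the last move has to be tested.\<close>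

definition closing_ok :: "cell \<Rightarrow> cell \<Rightarrow> cell \<Rightarrow> cell \<Rightarrow> bool" where
  "closing_ok v2 v3 v5 v4 \<longleftrightarrow>
    (if knight_move v3 v4
     then if distinct [(0, 0), (1, 2), v2, v3, v4, v5]
       then has_representative [(0, 0), (1, 2), v2, v3, v4, v5] else True
     else True)"

text \<open>Each neighbour list has eight entries, which makes 8 * 8 * 8 * 8 = 4096 combinations;
  only those that close up with distinct cells are matched.\<close>

lemma rooted_paths_have_representatives:
  "list_all (\<lambda>v2. list_all (\<lambda>v3. list_all (\<lambda>v5. list_all (closing_ok v2 v3 v5)
    (knight_nbrs v5)) (knight_nbrs (0, 0))) (knight_nbrs v2)) (knight_nbrs (1, 2))"
  by code_simp

text \<open>The case \<open>r = r'\<close> is excepted because the identity maps each representative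
  to itself.\<close>

definition separated :: "cell list \<Rightarrow> cell list \<Rightarrow> cell list \<Rightarrow> bool" where
  "separated r c r' \<longleftrightarrow> (if r = r' then True else \<not> same_cells c r')"

lemma representatives_separated:
  "list_all (\<lambda>r. list_all (\<lambda>g. list_all
    (separated r (normalize (map (signed_perm g) r))) representatives) signed_perms) representatives"
  by code_simp

lemma representatives_normalized:
  "list_all (\<lambda>r. r \<noteq> [] \<and> Min (fst ` set r) = 1 \<and> Min (snd ` set r) = 1) representatives"
  by code_simp

lemma representatives_traversable:
  "list_all (\<lambda>r. length r = 6 \<and> distinct r \<and> list_all (\<lambda>(i, j). 1 \<le> i \<and> i \<le> 7 \<and> 1 \<le> j \<and> j \<le> 7) r
    \<and> list_all (\<lambda>k. knight_move (r ! k) (r ! (k + 1))) [0..<5] \<and> knight_move (r ! 5) (r ! 0))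
    representatives"
  by code_simp

lemma distinct_representatives: "distinct representatives"
  by code_simp

section \<open>Completeness of the representatives\<close>

lemma same_cells_iff: "same_cells c d \<longleftrightarrow> set c = set d"
  by (auto simp: same_cells_def list_all_iff)

lemma congruent_normalize:
  assumes "g \<in> set signed_perms"
  shows "congruent_sets (set c) (set (normalize (map (signed_perm g) c)))"
  using assms unfolding congruent_sets_def normalize_def set_map by blast

lemma has_representativeD:
  assumes "has_representative c"
  obtains r where "r \<in> set representatives" "congruent_sets (set c) (set r)"
proof -
  obtain g r where "g \<in> set signed_perms" "r \<in> set representatives"
    "set (normalize (map (signed_perm g) c)) = set r"
    using assms by (auto simp: has_representative_def list_ex_iff same_cells_iff)
  then show thesis using congruent_normalize that by metis
qed

lemma closed_path_congruent_representative:
  assumes "A \<in> closed_knight_paths m 6"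
  obtains r where "r \<in> set representatives" "congruent_sets A (set r)"
proof -
  obtain c where c: "length c = 6" "distinct c" "set c = A"
    and moves: "\<And>k. k + 1 < 6 \<Longrightarrow> knight_move (c ! k) (c ! (k + 1))"
    and last: "knight_move (c ! 5) (c ! 0)"
    using assms by (auto simp: closed_knight_paths_def)
  obtain c0 c1 c2 c3 c4 c5 where cs: "c = [c0, c1, c2, c3, c4, c5]"
    using c(1) by (auto simp: numeral_eq_Suc length_Suc_conv)
  have km: "knight_move c0 c1" "knight_move c1 c2" "knight_move c2 c3" "knight_move c3 c4"
    "knight_move c4 c5" "knight_move c5 c0"
    using moves[of 0] moves[of 1] moves[of 2] moves[of 3] moves[of 4] last by (simp_all add: cs)
  obtain d where d: "d \<in> set knight_steps" "c1 = shift c0 d"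
    using knight_move_nbrs[OF km(1)] by (auto simp: knight_nbrs_def)
  obtain g where g: "g \<in> set signed_perms" "signed_perm g d = (1, 2)"
    using knight_step_rotatable d(1) by (auto simp: list_all_iff list_ex_iff)
  \<comment> \<open>The shift by \<open>t\<close> moves \<open>c0\<close> to the origin, and
    \<open>g\<close> then turns the first move into \<open>(1, 2)\<close>.\<close>
  define t where "t = (- fst c0, - snd c0)"
  define f where "f = (\<lambda>x. signed_perm g (shift t x))"
  have f0: "f c0 = (0, 0)" and f1: "f c1 = (1, 2)"
    using g(2) by (cases g; cases c0; cases d; simp add: f_def t_def d(2))+
  have fm: "knight_move (f x) (f y)" if "knight_move x y" for x y
    unfolding f_def by (intro knight_move_signed_perm knight_move_shift g(1) that)
  have "inj f"
    unfolding f_def using inj_compose[OF inj_signed_perm[OF g(1)] inj_shift[of t]] by (simp add: comp_def)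
  then have "distinct (map f c)"
    using c(2) by (auto simp: distinct_map intro: inj_on_subset)
  then have dist: "distinct [(0, 0), (1, 2), f c2, f c3, f c4, f c5]"
    by (simp add: cs f0 f1)
  \<comment> \<open>The arm through \<open>c5\<close> and \<open>c4\<close> is followed backwards
    from \<open>c0\<close>, hence the symmetry of knight moves.\<close>
  have "f c2 \<in> set (knight_nbrs (1, 2))" "f c3 \<in> set (knight_nbrs (f c2))"
    "f c5 \<in> set (knight_nbrs (0, 0))" "f c4 \<in> set (knight_nbrs (f c5))"
    using knight_move_nbrs fm knight_move_sym km f0 f1 by metis+
  then have "closing_ok (f c2) (f c3) (f c5) (f c4)"
    using rooted_paths_have_representatives unfolding list_all_iff by blast
  \<comment> \<open>The one move left, from \<open>c3\<close> to \<open>c4\<close>, passes the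
    closing test.\<close>
  with dist fm[OF km(4)] have "has_representative (map f c)"
    by (simp add: closing_ok_def cs f0 f1)
  then obtain r where r: "r \<in> set representatives" "congruent_sets (f ` A) (set r)"
    using has_representativeD[of "map f c"] c(3) by auto
  have "congruent_sets A (f ` A)"
    by (rule congruent_sets_image[OF g(1)]) (simp add: f_def signed_perm_shift)
  with r show thesis using that congruent_sets_trans by blast
qed

section \<open>Incongruence of the representatives\<close>

lemma Min_image_shift:
  assumes "finite A" "A \<noteq> {}"
  shows "Min (fst ` shift (p, q) ` A) = Min (fst ` A) + p"
    and "Min (snd ` shift (p, q) ` A) = Min (snd ` A) + q"
proof -
  have "fst ` shift (p, q) ` A = (\<lambda>x. fst x + p) ` A" "snd ` shift (p, q) ` A = (\<lambda>x. snd x + q) ` A"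
    by (force simp: image_iff)+
  then show "Min (fst ` shift (p, q) ` A) = Min (fst ` A) + p"
    and "Min (snd ` shift (p, q) ` A) = Min (snd ` A) + q"
    using Min_add_commute[OF assms] by metis+
qed

lemma representatives_incongruent:
  assumes r: "r \<in> set representatives" and r': "r' \<in> set representatives"
    and cong: "congruent_sets (set r) (set r')"
  shows "r = r'"
proof -
  obtain g p q where g: "g \<in> set signed_perms"
    and eq: "set r' = shift (p, q) ` signed_perm g ` set r"
    using cong by (auto simp: congruent_sets_def)
  let ?c = "map (signed_perm g) r"
  have "r \<noteq> []" "Min (fst ` set r') = 1" "Min (snd ` set r') = 1"
    using representatives_normalized r r' by (auto simp: list_all_iff)
  \<comment> \<open>Both minima of \<open>r'\<close> are 1, which determines the translation: it is
    the one that \<open>normalize\<close> applies.\<close>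
  then have "p = 1 - Min (fst ` set ?c)" "q = 1 - Min (snd ` set ?c)"
    using Min_image_shift[of "set ?c" p q] by (simp_all add: eq)
  then have "same_cells (normalize ?c) r'"
    by (simp add: same_cells_iff normalize_def eq image_image)
  moreover have "separated r (normalize ?c) r'"
    using representatives_separated r r' g unfolding list_all_iff by blast
  ultimately show ?thesis by (simp add: separated_def split: if_splits)
qed

section \<open>Counting the classes\<close>

lemma representative_closed_path:
  assumes "r \<in> set representatives"
  shows "set r \<in> closed_knight_paths 7 6"
proof -
  have r: "length r = 6" "distinct r" "\<forall>(i, j) \<in> set r. 1 \<le> i \<and> i \<le> 7 \<and> 1 \<le> j \<and> j \<le> 7"
    "\<forall>k<5. knight_move (r ! k) (r ! (k + 1))" "knight_move (r ! 5) (r ! 0)"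
    using representatives_traversable assms by (auto simp: list_all_iff)
  have "set r \<subseteq> board 7"
    using r(3) by (auto simp: board_def)
  with r show ?thesis
    unfolding closed_knight_paths_def by (auto intro!: exI[of _ r])
qed

theorem mainTheorem2:
  shows "card (closed_knight_paths 7 6 // path_equiv 7 6) = 25"
proof -
  let ?P = "closed_knight_paths 7 6" and ?E = "path_equiv 7 6"
  let ?cls = "\<lambda>r. ?E `` {set r}"
  have equiv: "equiv ?P ?E" by (rule equiv_path_equiv)
  have inj: "inj_on ?cls (set representatives)"
  proof (rule inj_onI)
    fix r r' assume r: "r \<in> set representatives" "r' \<in> set representatives" "?cls r = ?cls r'"
    then have "(set r, set r') \<in> ?E"
      using eq_equiv_class[OF _ equiv] representative_closed_path by metis
    then have "congruent_sets (set r) (set r')"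
      by (auto simp: path_equiv_def intro: rtrancl_elementary_step_imp_congruent)
    with r show "r = r'" using representatives_incongruent by blast
  qed
  \<comment> \<open>Injectivity gives at least 25 classes; the search shows that there are no
    others.\<close>
  have "?P // ?E = ?cls ` set representatives"
  proof
    show "?cls ` set representatives \<subseteq> ?P // ?E"
      using representative_closed_path by (auto intro: quotientI)
    show "?P // ?E \<subseteq> ?cls ` set representatives"
    proof
      fix X assume "X \<in> ?P // ?E"
      then obtain A where A: "A \<in> ?P" "X = ?E `` {A}" by (rule quotientE)
      obtain r where r: "r \<in> set representatives" "congruent_sets A (set r)"
        using closed_path_congruent_representative A(1) by blast
      have rP: "set r \<in> ?P" using representative_closed_path r(1) .
      then have "(A, set r) \<in> (elementary_step 7)\<^sup>*"
        using A(1) r(2) by (intro congruent_imp_reachable) (auto simp: closed_knight_paths_def)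
      then have "(A, set r) \<in> ?E"
        using A(1) rP by (simp add: path_equiv_def)
      then have "X = ?cls r"
        using equiv_class_eq[OF equiv] A(2) by blast
      with r(1) show "X \<in> ?cls ` set representatives" by blast
    qed
  qed
  then have "card (?P // ?E) = length representatives"
    using inj distinct_representatives by (simp add: card_image distinct_card)
  then show ?thesis by (simp add: representatives_def)
qed

end
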